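(* Let $\mathcal{A}$ be a finite-dimensional algebra over a field $\mathbb{F}$ which is descendingly flexible or descendingly alternative, let $S\subseteq\mathcal{A}$, and consider the swappability relation $\leftrightarrow$ on the letters of a word $x\in S^\infty$. (1) The relation $\leftrightarrow$ is symmetric and transitive. (2) If $x \in S^m$, $s, t$ are letters of $x$, and $s \leftrightarrow t$, then $s = t$ (equality as elements of $S$) implies $x \in \mathcal{L}_{m-1}(S)$. (3) If $x \in S^m$, and for some $n > |S|$ the letters $s_1, \dots, s_n$ of $x$ are pairwise swappable, then $x \in \mathcal{L}_{m-1}(S)$.
   Context: $\mathcal{A}$ is possibly non-unital and non-associative. If $\mathcal{A}$ is unital, its unity is denoted by $e$. For $a,b,c\in\mathcal{A}$ let $\mathcal{L}'_2(a,b,c)$ be the span of $a,b,c,ab,ba,cb,bc,ac,ca$ (together with $e$ if $\mathcal{A}$ is unital), and let $\mathcal{L}_1(a,b,aa,ab,ba)$ be the span of $a,b,aa,ab,ba$ (together with $e$ if $\mathcal{A}$ is unital). $\mathcal{A}$ is descendingly flexible if for all $a,b,c\in\mathcal{A}$: $(ab)a,\ a(ba) \in \mathcal{L}_1(a,b,aa,ab,ba)$; $(ab)c+(cb)a\in\mathcal{L}'_2(a,b,c)$; $a(bc)+c(ba)\in\mathcal{L}'_2(a,b,c)$. $\mathcal{A}$ is descendingly alternative if for all $a,b,c\in\mathcal{A}$: $(ba)a,\ a(ab) \in \mathcal{L}_1(a,b,aa,ab,ba)$; $(ab)c+(ac)b\in\mathcal{L}'_2(a,b,c)$; $a(bc)+b(ac)\in\mathcal{L}'_2(a,b,c)$.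 Words. A word of length $k\ge1$ in $S$ is a product of $k$ elements (letters) of $S$ with some arrangement of brackets; $e$ is a word of length $0$ if $\mathcal{A}$ is unital, otherwise there are no words of length $0$. Words are regarded as bracketed expressions, also identified with their values in $\mathcal{A}$; the length of a word is the number of letters in its notation. Letters of a word are regarded as occurrences (so distinct letters of a word may be equal as elements of $S$). $S^k$ is the set of words of length at most $k$, $S^\infty=\bigcup_k S^k$, $\pm S^\infty$ is the set of words with a sign $+$ or $-$, and $\mathcal{L}_k(S)$ is the linear span of $S^k$. $L_a(x)=ax$, $R_a(x)=xa$. Equivalence. For $x,y\in\pm S^\infty$ of the same length $m\ge1$, $x\sim y$ means $x-y\in\mathcal{L}_{m-1}(S)$. Formal equivalence. Elementary equivalences are defined inductively. For words $a,b,c$ of length $\ge1$: if $\mathcal{A}$ is descendingly flexible, $(ab)c\sim-(cb)a$ and $a(bc)\sim-c(ba)$ are elementary; if $\mathcal{A}$ is descendingly alternative, $(ab)c\sim-(ac)b$ and $a(bc)\sim-b(ac)$ are elementary. If $u\sim v$ is elementary and $z\in S^\infty$, then $uz\sim vz$ and $zu\sim zv$ are elementary. Two signed words are formally equivalent if they are connected by a chain of elementary equivalences. Swappability. Two (distinct occurrences of) letters $s,t$ of a word $x\in S^\infty$ are swappable, $s\leftrightarrow t$, if: in the descendingly flexible case, $x$ is formally equivalent to some (signed) word of the form $\dots R_sL_t\dots$ or $\dots L_sR_t\dots$; in the descendingly alternative case, $x$ is formally equivalent to some (signed) word of the form $\dots R_sR_t\dots$ or $\dots L_sL_t\dots$.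 Here a word of the form $\dots X_sY_t\dots$ with $X,Y\in\{L,R\}$ is one containing a subword $X_sY_t(v)$ for some nonempty word $v$, and occurrences of letters are tracked through the elementary equivalences. In the statement, the descendingly flexible and the descendingly alternative case are treated separately, each with its own relation $\leftrightarrow$; transitivity refers to distinct occurrences $s,t,u$. *)

theory Defs
  imports Complex_Main
begin

section \<open>Algebras\<close>

locale nonassoc_algebra = vector_space scale
  for scale :: "'f::field \<Rightarrow> 'a::ab_group_add \<Rightarrow> 'a" (infixr \<open>*s\<close> 75) +
  fixes mult :: "'a \<Rightarrow> 'a \<Rightarrow> 'a" (infixl \<open>\<cdot>\<close> 70)
  assumes linear_mult_left: "Vector_Spaces.linear (*s) (*s) (\<lambda>x. x \<cdot> a)"
    and linear_mult_right: "Vector_Spaces.linear (*s) (*s) (\<lambda>x. a \<cdot> x)"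

text \<open>
  Two properties are considered in parallel. The value of type \<open>kind\<close> says which of them
  (and which of the corresponding equivalences of words) is meant.
\<close>

datatype kind = Flexible | Alternative

context nonassoc_algebra
begin

text \<open>This set is \<open>{e}\<close> if the algebra is unital with unity \<open>e\<close>, and empty otherwise.\<close>

definition unities :: "'a set" where
  "unities = {e. \<forall>a. e \<cdot> a = a \<and> a \<cdot> e = a}"

definition L1 :: "'a \<Rightarrow> 'a \<Rightarrow> 'a set" where
  "L1 a b = span ({a, b, a \<cdot> a, a \<cdot> b, b \<cdot> a} \<union> unities)"

definition L2' :: "'a \<Rightarrow> 'a \<Rightarrow> 'a \<Rightarrow> 'a set" where
  "L2' a b c = span ({a, b, c, a \<cdot> b, b \<cdot> a, c \<cdot> b, b \<cdot> c, a \<cdot> c, c \<cdot> a} \<union> unities)"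

definition descendingly_flexible :: bool where
  "descendingly_flexible \<longleftrightarrow> (\<forall>a b c.
     (a \<cdot> b) \<cdot> a \<in> L1 a b \<and> a \<cdot> (b \<cdot> a) \<in> L1 a b \<and>
     (a \<cdot> b) \<cdot> c + (c \<cdot> b) \<cdot> a \<in> L2' a b c \<and>
     a \<cdot> (b \<cdot> c) + c \<cdot> (b \<cdot> a) \<in> L2' a b c)"

definition descendingly_alternative :: bool where
  "descendingly_alternative \<longleftrightarrow> (\<forall>a b c.
     (b \<cdot> a) \<cdot> a \<in> L1 a b \<and> a \<cdot> (a \<cdot> b) \<in> L1 a b \<and>
     (a \<cdot> b) \<cdot> c + (a \<cdot> c) \<cdot> b \<in> L2' a b c \<and>
     a \<cdot> (b \<cdot> c) + b \<cdot> (a \<cdot> c) \<in> L2' a b c)"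

fun descending :: "kind \<Rightarrow> bool" where
  "descending Flexible = descendingly_flexible"
| "descending Alternative = descendingly_alternative"

end

section \<open>Words\<close>

text \<open>
  Bracketed expressions of length at least 1. The word \<open>e\<close> of length 0, which has no letters,
  is not represented here; its value enters the spans \<open>L\<close> below through \<open>unities\<close>.
\<close>

datatype (letters: 'l) word =
    Letter 'l
  | Times "'l word" "'l word" (infixl \<open>\<odot>\<close> 70)

primrec wlength :: "'l word \<Rightarrow> nat" where
  "wlength (Letter s) = 1"
| "wlength (u \<odot> v) = wlength u + wlength v"

definition words_upto :: "'l set \<Rightarrow> nat \<Rightarrow> 'l word set" where
  "words_upto S k = {w. letters w \<subseteq> S \<and> wlength w \<le> k}"

definition words :: "'l set \<Rightarrow> 'l word set" where
  "words S = (\<Union>k. words_upto S k)"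

context nonassoc_algebra
begin

primrec eval :: "'a word \<Rightarrow> 'a" where
  "eval (Letter s) = s"
| "eval (u \<odot> v) = eval u \<cdot> eval v"

definition L :: "'a set \<Rightarrow> nat \<Rightarrow> 'a set" where
  "L S k = span (eval ` words_upto S k \<union> unities)"

end

section \<open>Formal equivalence and swappable letters\<close>

text \<open>
  A signed word is a pair whose first component is \<open>True\<close> for the sign \<open>-\<close> and
  \<open>False\<close> for the sign \<open>+\<close>.
\<close>

type_synonym 'l signed_word = "bool \<times> 'l word"

text \<open>
  The sign \<open>p\<close> is arbitrary, so that with \<open>u \<sim> v\<close> also \<open>-u \<sim> -v\<close> is elementary.
  A factor \<open>z = e\<close> in the last two rules would change nothing.
\<close>

inductive elementary :: "kind \<Rightarrow> 'l signed_word \<Rightarrow> 'l signed_word \<Rightarrow> bool" where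
  flexible1: "elementary Flexible (p, (a \<odot> b) \<odot> c) (\<not> p, (c \<odot> b) \<odot> a)"
| flexible2: "elementary Flexible (p, a \<odot> (b \<odot> c)) (\<not> p, c \<odot> (b \<odot> a))"
| alternative1: "elementary Alternative (p, (a \<odot> b) \<odot> c) (\<not> p, (a \<odot> c) \<odot> b)"
| alternative2: "elementary Alternative (p, a \<odot> (b \<odot> c)) (\<not> p, b \<odot> (a \<odot> c))"
| times_right: "elementary k (p, u) (q, v) \<Longrightarrow> elementary k (p, u \<odot> z) (q, v \<odot> z)"
| times_left: "elementary k (p, u) (q, v) \<Longrightarrow> elementary k (p, z \<odot> u) (q, z \<odot> v)"

definition formally_equivalent :: "kind \<Rightarrow> 'l signed_word \<Rightarrow> 'l signed_word \<Rightarrow> bool" where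
  "formally_equivalent k = equivclp (elementary k)"

text \<open>
  To track occurrences of letters through equivalences, every letter of a word is paired with
  its position, counted from 0 on the left. An occurrence of the letter \<open>a\<close> is then a pair
  \<open>(i, a)\<close>; all letters of \<open>number_from 0 x\<close> are distinct, and formal equivalence is
  applied to words over such pairs.
\<close>

primrec number_from :: "nat \<Rightarrow> 'a word \<Rightarrow> (nat \<times> 'a) word" where
  "number_from n (Letter a) = Letter (n, a)"
| "number_from n (u \<odot> v) = number_from n u \<odot> number_from (n + wlength u) v"

definition occurrences :: "'a word \<Rightarrow> (nat \<times> 'a) set" where
  "occurrences x = letters (number_from 0 x)"

primrec subwords :: "'l word \<Rightarrow> 'l word set" where
  "subwords (Letter s) = {Letter s}"
| "subwords (u \<odot> v) = {u \<odot> v} \<union> subwords u \<union> subwords v"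

definition LL :: "'l \<Rightarrow> 'l word \<Rightarrow> 'l word" where
  "LL s v = Letter s \<odot> v"

definition RR :: "'l \<Rightarrow> 'l word \<Rightarrow> 'l word" where
  "RR s v = v \<odot> Letter s"

fun swap_form :: "kind \<Rightarrow> 'l \<Rightarrow> 'l \<Rightarrow> 'l word \<Rightarrow> bool" where
  "swap_form Flexible s t y \<longleftrightarrow> (\<exists>v. RR s (LL t v) \<in> subwords y \<or> LL s (RR t v) \<in> subwords y)"
| "swap_form Alternative s t y \<longleftrightarrow> (\<exists>v. RR s (RR t v) \<in> subwords y \<or> LL s (LL t v) \<in> subwords y)"

definition swappable :: "kind \<Rightarrow> 'a word \<Rightarrow> nat \<times> 'a \<Rightarrow> nat \<times> 'a \<Rightarrow> bool" where
  "swappable k x s t \<longleftrightarrow>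
     s \<in> occurrences x \<and> t \<in> occurrences x \<and> s \<noteq> t \<and>
     (\<exists>p y. formally_equivalent k (False, number_from 0 x) (p, y) \<and> swap_form k s t y)"

end

(*
  Write \<tau> for the transposition of two occurrences s, t of x. If x \<sim> \<plusminus>y and y contains one of the
  patterns defining s \<leftrightarrow> t, then y \<sim> -\<tau>y by one elementary step; renaming letters respects formal
  equivalence, so also x \<sim> -\<tau>x. Symmetry is immediate from the step y \<sim> -\<tau>y; for transitivity, apply the
  transposition of t and u to a word that witnesses s \<leftrightarrow> t. If s and t have the same value, the
  pattern in y is a product such as (s v) s, which the first two axioms make a combination of
  shorter words. Part (3) reduces to part (2) by the pigeonhole principle.
*)
theory Submission
  imports Defs "HOL-Combinatorics.Transposition"
begin

section \<open>Words and formal equivalence\<close>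

lemma wlength_pos [simp]: "wlength w > 0"
  by (induction w) auto

lemma finite_letters [simp]: "finite (letters w)"
  by (induction w) auto

lemma card_letters_le: "card (letters w) \<le> wlength w"
proof (induction w)
  case (Times u v)
  then show ?case
    using card_Un_le[of "letters u" "letters v"] by simp
qed simp

lemma wlength_map_word [simp]: "wlength (map_word f w) = wlength w"
  by (induction w) auto

lemma subwords_map_word: "subwords (map_word f w) = map_word f ` subwords w"
  by (induction w) auto

lemma letters_subwords: "v \<in> subwords w \<Longrightarrow> letters v \<subseteq> letters w"
  by (induction w) auto

section \<open>Numbered words and distinctness of letters\<close>

lemma wlength_number_from [simp]: "wlength (number_from n w) = wlength w"
  by (induction w arbitrary: n) auto

lemma map_word_snd_number_from [simp]: "map_word snd (number_from n w) = w"
  by (induction w arbitrary: n) auto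

lemma fst_letters_number_from: "fst ` letters (number_from n w) = {n..<n + wlength w}"
proof (induction w arbitrary: n)
  case (Times u v)
  then show ?case
    by (simp add: image_Un ivl_disj_un_two(3) add.assoc)
qed auto

text \<open>The positions alone take \<open>wlength w\<close> values, which bounds the letter set
  from below. Thus numbered words have pairwise distinct letters.\<close>

lemma card_letters_number_from [simp]: "card (letters (number_from n w)) = wlength w"
proof (rule antisym)
  show "card (letters (number_from n w)) \<le> wlength w"
    using card_letters_le[of "number_from n w"] by simp
  show "wlength w \<le> card (letters (number_from n w))"
    using card_image_le[of "letters (number_from n w)" fst]
    by (simp add: fst_letters_number_from)
qed

text \<open>
  The hypothesis \<open>card (letters w) = wlength w\<close> says that the letters of \<open>w\<close> are distinct.
\<close>

lemma distinct_letters_Times: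
  assumes "card (letters (u \<odot> v)) = wlength (u \<odot> v)"
  shows "card (letters u) = wlength u" "card (letters v) = wlength v"
    "letters u \<inter> letters v = {}"
proof -
  have "card (letters u \<union> letters v) + card (letters u \<inter> letters v) =
      card (letters u) + card (letters v)"
    using card_Un_Int[of "letters u" "letters v"] by simp
  \<comment> \<open>Both cardinalities on the right are at most the lengths, while the union attains
    the sum of the lengths; so both bounds are attained and the intersection is empty.\<close>
  then have *: "card (letters u) = wlength u \<and> card (letters v) = wlength v \<and>
      card (letters u \<inter> letters v) = 0"
    using assms card_letters_le[of u] card_letters_le[of v]
    by (simp del: card_0_eq)
  then show "card (letters u) = wlength u" "card (letters v) = wlength v"
    "letters u \<inter> letters v = {}"
    by auto
qed

lemma map_word_transpose_fresh:
  assumes "s \<notin> letters w" "t \<notin> letters w"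
  shows "map_word (transpose s t) w = w"
proof -
  have "map_word (transpose s t) w = map_word id w"
    using assms by (intro word.map_cong) (auto simp: transpose_def)
  then show ?thesis
    by (simp add: word.map_id)
qed

section \<open>Invariants and renaming under formal equivalence\<close>

lemma elementary_invariants:
  assumes "elementary k x y"
  shows "letters (snd y) = letters (snd x)" "wlength (snd y) = wlength (snd x)"
  using assms by (induction rule: elementary.induct) auto

text \<open>The rules hold for arbitrary words, so any renaming \<open>f\<close>, injective or not,
  respects them. The comparison with \<open>b\<close> flips both signs when \<open>b\<close> is
  true. Later \<open>f\<close> is a transposition, or \<open>snd\<close> to forget
  positions.\<close>

lemma elementary_map:
  assumes "elementary k x y"
  shows "elementary k (fst x \<noteq> b, map_word f (snd x)) (fst y \<noteq> b, map_word f (snd y))"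
  using assms
  \<comment> \<open>For true \<open>b\<close> the required signs are \<open>\<not> p\<close> and
    \<open>p\<close>, so the first four rules are also supplied at \<open>\<not> p\<close> with the
    double negation removed.\<close>
  by (induction rule: elementary.induct; cases b)
    (auto intro: elementary.intros elementary.intros(1-4)[of "\<not> p" for p, simplified])

lemma formally_equivalent_induct [consumes 1, case_names refl step]:
  assumes "formally_equivalent k x y"
    and "P x"
    and "\<And>y z. P y \<Longrightarrow> elementary k y z \<or> elementary k z y \<Longrightarrow> P z"
  shows "P y"
  using assms(1)[unfolded formally_equivalent_def] assms(2,3)
  by (induction rule: equivclp_induct) blast+

lemma formally_equivalent_trans:
  "formally_equivalent k x y \<Longrightarrow> formally_equivalent k y z \<Longrightarrow> formally_equivalent k x z"
  unfolding formally_equivalent_def by (rule equivclp_trans)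

lemma formally_equivalent_sym: "formally_equivalent k x y \<Longrightarrow> formally_equivalent k y x"
  unfolding formally_equivalent_def by (rule equivclp_sym)

lemma elementary_imp_formally_equivalent: "elementary k x y \<Longrightarrow> formally_equivalent k x y"
  unfolding formally_equivalent_def by (rule r_into_equivclp)

lemma formally_equivalent_invariants:
  assumes "formally_equivalent k x y"
  shows "letters (snd y) = letters (snd x) \<and> wlength (snd y) = wlength (snd x)"
  using assms by (induction rule: formally_equivalent_induct) (auto dest: elementary_invariants)

lemma formally_equivalent_map:
  assumes "formally_equivalent k x y"
  shows "formally_equivalent k (fst x \<noteq> b, map_word f (snd x)) (fst y \<noteq> b, map_word f (snd y))"
  using assms
proof (induction rule: formally_equivalent_induct)
  case refl
  then show ?case
    by (simp add: formally_equivalent_def)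
next
  case (step y z)
  from step(2) have "formally_equivalent k (fst y \<noteq> b, map_word f (snd y)) (fst z \<noteq> b, map_word f (snd z))"
    by (blast intro: elementary_map elementary_imp_formally_equivalent formally_equivalent_sym)
  with step(1) show ?case
    by (rule formally_equivalent_trans)
qed

section \<open>Swappable letters\<close>

lemma swap_form_Letter [simp]: "\<not> swap_form k s t (Letter a)"
  by (cases k) (auto simp: LL_def RR_def)

text \<open>Locating the pattern at the root or inside one factor makes induction on the word
  available.\<close>

lemma swap_form_Times:
  "swap_form k s t (u \<odot> w) \<longleftrightarrow>
     (\<exists>v. case k of
        Flexible \<Rightarrow> u \<odot> w = (Letter t \<odot> v) \<odot> Letter s \<or> u \<odot> w = Letter s \<odot> (v \<odot> Letter t)
      | Alternative \<Rightarrow> u \<odot> w = (v \<odot> Letter t) \<odot> Letter s \<or> u \<odot> w = Letter s \<odot> (Letter t \<odot> v))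
     \<or> swap_form k s t u \<or> swap_form k s t w"
  by (cases k) (auto simp: LL_def RR_def)

lemma swap_form_letters: "swap_form k s t y \<Longrightarrow> s \<in> letters y \<and> t \<in> letters y"
  by (cases k) (auto simp: LL_def RR_def dest!: letters_subwords)

text \<open>The pattern is a matter of shape, which renaming keeps even when \<open>f\<close>
  identifies \<open>s\<close> and \<open>t\<close>; that case arises for
  \<open>f = snd\<close>.\<close>

lemma swap_form_map: "swap_form k s t y \<Longrightarrow> swap_form k (f s) (f t) (map_word f y)"
  by (induction y) (auto simp: swap_form_Times split: kind.splits)

text \<open>At the pattern, one basic rule exchanges \<open>s\<close> and \<open>t\<close> and flips
  the sign. Since the letters are distinct, neither occurs anywhere else, so this local exchange is
  the transposition of the whole word.\<close>

lemma swap_form_elementary: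
  assumes "swap_form k s t y" "card (letters y) = wlength y"
  shows "elementary k (p, y) (\<not> p, map_word (transpose s t) y)"
  using assms
proof (induction y)
  case (Times u w)
  note distinct = distinct_letters_Times[OF Times.prems(2)]
  from Times.prems(1) consider
      (top) v where "case k of
        Flexible \<Rightarrow> u \<odot> w = (Letter t \<odot> v) \<odot> Letter s \<or> u \<odot> w = Letter s \<odot> (v \<odot> Letter t)
      | Alternative \<Rightarrow> u \<odot> w = (v \<odot> Letter t) \<odot> Letter s \<or> u \<odot> w = Letter s \<odot> (Letter t \<odot> v)"
    | (left) "swap_form k s t u" | (right) "swap_form k s t w"
    unfolding swap_form_Times by blast
  then show ?case
  proof cases
    case top
    then have "s \<notin> letters v" "t \<notin> letters v"
      using distinct
      by (auto split: kind.splits dest: distinct_letters_Times(3))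
    with top show ?thesis
      by (auto simp: map_word_transpose_fresh split: kind.splits intro: elementary.intros)
  next
    case left
    then have "s \<notin> letters w" "t \<notin> letters w"
      using distinct(3) swap_form_letters by fast+
    with Times.IH(1)[OF left distinct(1)] show ?thesis
      by (simp add: map_word_transpose_fresh elementary.times_right)
  next
    case right
    then have "s \<notin> letters u" "t \<notin> letters u"
      using distinct(3) swap_form_letters by fast+
    with Times.IH(2)[OF right distinct(2)] show ?thesis
      by (simp add: map_word_transpose_fresh elementary.times_left)
  qed
qed simp

text \<open>The numbered word has distinct letters, and equivalence keeps the letter set and the
  length; hence the witness \<open>y\<close> has distinct letters too and admits the exchange
  step.\<close>

lemma swappableE:
  assumes "swappable k x s t"
  obtains p y where "formally_equivalent k (False, number_from 0 x) (p, y)" "swap_form k s t y"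
    "elementary k (p, y) (\<not> p, map_word (transpose s t) y)"
proof -
  from assms obtain p y where y: "formally_equivalent k (False, number_from 0 x) (p, y)"
      "swap_form k s t y"
    unfolding swappable_def by blast
  from formally_equivalent_invariants[OF y(1)] have "card (letters y) = wlength y"
    by simp
  with y show thesis
    by (blast intro: that swap_form_elementary)
qed

lemma swappable_sym:
  assumes "swappable k x s t"
  shows "swappable k x t s"
proof -
  from assms obtain p y where y: "formally_equivalent k (False, number_from 0 x) (p, y)"
      "swap_form k s t y" "elementary k (p, y) (\<not> p, map_word (transpose s t) y)"
    by (rule swappableE)
  have "formally_equivalent k (False, number_from 0 x) (\<not> p, map_word (transpose s t) y)"
    using y by (blast intro: formally_equivalent_trans elementary_imp_formally_equivalent)
  moreover have "swap_form k t s (map_word (transpose s t) y)"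
    using swap_form_map[OF y(2), of "transpose s t"] by simp
  ultimately show ?thesis
    using assms unfolding swappable_def by blast
qed

text \<open>With \<tau> the transposition and y the witness, the chain is x \<sim> \<plusminus>y
  \<sim> \<mp>\<tau>y \<sim> -\<tau>x. The last link is the first one, reversed, renamed by \<tau>
  and negated.\<close>

lemma swappable_transpose:
  assumes "swappable k x s t"
  shows "formally_equivalent k (False, number_from 0 x)
    (True, map_word (transpose s t) (number_from 0 x))"
proof -
  from assms obtain p y where y: "formally_equivalent k (False, number_from 0 x) (p, y)"
      "elementary k (p, y) (\<not> p, map_word (transpose s t) y)"
    by (rule swappableE)
  have "formally_equivalent k (True, map_word (transpose s t) (number_from 0 x))
      (\<not> p, map_word (transpose s t) y)"
    using formally_equivalent_map[OF y(1), of True "transpose s t"] by simp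
  with y show ?thesis
    by (blast intro: formally_equivalent_trans formally_equivalent_sym
        elementary_imp_formally_equivalent)
qed

lemma swappable_trans:
  assumes "swappable k x s t" "swappable k x t u" "s \<noteq> u"
  shows "swappable k x s u"
proof -
  from assms(1) obtain p y where y: "formally_equivalent k (False, number_from 0 x) (p, y)"
      "swap_form k s t y"
    by (rule swappableE)
  \<comment> \<open>As \<open>s\<close> differs from both \<open>t\<close> and \<open>u\<close>, the
    renaming \<open>transpose t u\<close> fixes it and turns the pattern for \<open>s\<close>,
    \<open>t\<close> into one for \<open>s\<close>, \<open>u\<close>.\<close>
  have "s \<noteq> t"
    using assms(1) by (simp add: swappable_def)
  with \<open>s \<noteq> u\<close> have "swap_form k s u (map_word (transpose t u) y)"
    using swap_form_map[OF y(2), of "transpose t u"] by simp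
  \<comment> \<open>The renamed witness is thereby tied to the renamed word with sign minus, which
    \<open>swappable_transpose\<close> connects to \<open>x\<close> because \<open>t\<close> and
    \<open>u\<close> are swappable.\<close>
  moreover have "formally_equivalent k (True, map_word (transpose t u) (number_from 0 x))
      (\<not> p, map_word (transpose t u) y)"
    using formally_equivalent_map[OF y(1), of True "transpose t u"] by simp
  ultimately show ?thesis
    using assms swappable_transpose[OF assms(2)] formally_equivalent_trans
    unfolding swappable_def by blast
qed

section \<open>Values of words\<close>

context nonassoc_algebra
begin

section \<open>Bilinearity of the product\<close>

lemma mult_add_right: "a \<cdot> (x + y) = a \<cdot> x + a \<cdot> y"
  using linear_mult_right by (simp add: Vector_Spaces.linear_iff)

lemma mult_add_left: "(x + y) \<cdot> a = x \<cdot> a + y \<cdot> a"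
  using linear_mult_left by (simp add: Vector_Spaces.linear_iff)

lemma mult_scale_right: "a \<cdot> (r *s x) = r *s (a \<cdot> x)"
  using linear_mult_right by (simp add: Vector_Spaces.linear_iff)

lemma mult_scale_left: "(r *s x) \<cdot> a = r *s (x \<cdot> a)"
  using linear_mult_left by (simp add: Vector_Spaces.linear_iff)

lemma mult_zero_right: "a \<cdot> 0 = 0"
  using mult_add_right[of a 0 0] by simp

lemma mult_zero_left: "0 \<cdot> a = 0"
  using mult_add_left[of 0 0 a] by simp

lemma mult_minus_right: "a \<cdot> (- x) = - (a \<cdot> x)"
  using mult_add_right[of a x "- x"] by (simp add: mult_zero_right minus_unique)

lemma mult_minus_left: "(- x) \<cdot> a = - (x \<cdot> a)"
  using mult_add_left[of x "- x" a] by (simp add: mult_zero_left minus_unique)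

text \<open>By bilinearity it suffices to check generators: first \<open>y\<close> becomes arbitrary
  for a fixed generator \<open>a\<close>, then \<open>x\<close> does.\<close>

lemma mult_mem_span:
  assumes "x \<in> span A" "y \<in> span B" and AB: "\<And>a b. a \<in> A \<Longrightarrow> b \<in> B \<Longrightarrow> a \<cdot> b \<in> span C"
  shows "x \<cdot> y \<in> span C"
proof -
  have left: "a \<cdot> y \<in> span C" if "a \<in> A" for a
    using assms(2)
  proof (induction rule: span_induct_alt)
    case base
    then show ?case by (simp add: mult_zero_right span_zero)
  next
    case (step c b z)
    with AB[OF that] show ?case
      by (simp add: mult_add_right mult_scale_right span_add span_scale)
  qed
  from assms(1) show ?thesis
  proof (induction rule: span_induct_alt)
    case base
    then show ?case by (simp add: mult_zero_left span_zero)
  next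
    case (step c b z)
    with left show ?case
      by (simp add: mult_add_left mult_scale_left span_add span_scale)
  qed
qed

section \<open>The filtration by word length\<close>

lemma L_mono: "i \<le> j \<Longrightarrow> x \<in> L S i \<Longrightarrow> x \<in> L S j"
  unfolding L_def words_upto_def by (erule set_rev_mp) (intro span_mono, auto)

lemma eval_mem_L: "letters w \<subseteq> S \<Longrightarrow> wlength w \<le> k \<Longrightarrow> eval w \<in> L S k"
  unfolding L_def words_upto_def by (auto intro: span_base)

lemma unities_mem_L: "e \<in> unities \<Longrightarrow> e \<in> L S k"
  unfolding L_def by (auto intro: span_base)

text \<open>Lengths add when two words are multiplied. The empty word is present only through
  \<open>unities\<close>, so a product with a unity is treated apart: it equals one of the
  factors.\<close>

lemma L_mult:
  assumes "x \<in> L S i" "y \<in> L S j"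
  shows "x \<cdot> y \<in> L S (i + j)"
proof -
  have "a \<cdot> b \<in> L S (i + j)"
    if "a \<in> eval ` words_upto S i \<union> unities" "b \<in> eval ` words_upto S j \<union> unities" for a b
  proof -
    have ab: "a \<in> L S i" "b \<in> L S j"
      using that unfolding L_def by (auto intro: span_base)
    show ?thesis
    proof (cases "a \<in> unities \<or> b \<in> unities")
      case True
      then have "a \<cdot> b = a \<or> a \<cdot> b = b"
        by (auto simp: unities_def)
      with ab show ?thesis
        using L_mono[of i "i + j" a] L_mono[of j "i + j" b] by auto
    next
      case False
      with that obtain u v where "a = eval u" "u \<in> words_upto S i"
          "b = eval v" "v \<in> words_upto S j"
        by blast
      then show ?thesis
        using eval_mem_L[of "u \<odot> v" S "i + j"] by (auto simp: words_upto_def)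
    qed
  qed
  with assms show ?thesis
    unfolding L_def by (rule mult_mem_span)
qed

text \<open>A drop in length survives multiplication: as \<open>wlength u\<close> is positive,
  \<open>(wlength u - 1) + wlength z\<close> is exactly one less than the length of the
  product.\<close>

lemma L_times_right:
  assumes "x \<in> L S (wlength u - 1)" "letters z \<subseteq> S"
  shows "x \<cdot> eval z \<in> L S (wlength (u \<odot> z) - 1)"
  using L_mult[OF assms(1) eval_mem_L[OF assms(2) order_refl]] wlength_pos[of u] by simp

lemma L_times_left:
  assumes "x \<in> L S (wlength u - 1)" "letters z \<subseteq> S"
  shows "eval z \<cdot> x \<in> L S (wlength (z \<odot> u) - 1)"
  using L_mult[OF eval_mem_L[OF assms(2) order_refl] assms(1)] wlength_pos[of u] by simp

text \<open>The bound is one less than the length of a word such as (s v) s. The square of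
  \<open>s\<close> obeys it because \<open>v\<close> has at least one letter.\<close>

lemma L1_subset_L:
  assumes "s \<in> S" "letters v \<subseteq> S"
  shows "L1 s (eval v) \<subseteq> L S (wlength v + 1)"
proof -
  have "eval w \<in> L S (wlength v + 1)"
    if "w \<in> {Letter s, v, Letter s \<odot> Letter s, Letter s \<odot> v, v \<odot> Letter s}" for w
    using that assms wlength_pos[of v] by (intro eval_mem_L) (auto simp: Suc_le_eq)
  from this[of "Letter s"] this[of v] this[of "Letter s \<odot> Letter s"]
    this[of "Letter s \<odot> v"] this[of "v \<odot> Letter s"]
  have "{s, eval v, s \<cdot> s, s \<cdot> eval v, eval v \<cdot> s} \<union> unities \<subseteq> L S (wlength v + 1)"
    using unities_mem_L by auto
  then show ?thesis
    unfolding L1_def L_def by (rule span_minimal) simp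
qed

text \<open>Every generating product omits one of the nonempty words \<open>a\<close>,
  \<open>b\<close>, \<open>c\<close>, so it is shorter than a product of all three.\<close>

lemma L2'_subset_L:
  assumes "letters a \<subseteq> S" "letters b \<subseteq> S" "letters c \<subseteq> S"
  shows "L2' (eval a) (eval b) (eval c) \<subseteq> L S (wlength a + wlength b + wlength c - 1)"
proof -
  let ?L = "L S (wlength a + wlength b + wlength c - 1)"
  have "eval w \<in> ?L"
    if "w \<in> {a, b, c, a \<odot> b, b \<odot> a, c \<odot> b, b \<odot> c, a \<odot> c, c \<odot> a}" for w
    using that assms wlength_pos[of a] wlength_pos[of b] wlength_pos[of c]
    by (intro eval_mem_L) (auto simp del: wlength_pos)
  from this[of a] this[of b] this[of c] this[of "a \<odot> b"] this[of "b \<odot> a"]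
    this[of "c \<odot> b"] this[of "b \<odot> c"] this[of "a \<odot> c"] this[of "c \<odot> a"]
  have "{eval a, eval b, eval c, eval a \<cdot> eval b, eval b \<cdot> eval a, eval c \<cdot> eval b,
      eval b \<cdot> eval c, eval a \<cdot> eval c, eval c \<cdot> eval a} \<union> unities \<subseteq> ?L"
    using unities_mem_L by auto
  then show ?thesis
    unfolding L2'_def L_def by (rule span_minimal) simp
qed

section \<open>Values of formally equivalent signed words\<close>

definition signed_eval :: "'a signed_word \<Rightarrow> 'a" where
  "signed_eval x = (if fst x then - eval (snd x) else eval (snd x))"

lemma signed_eval_times_right: "signed_eval (p, u \<odot> z) = signed_eval (p, u) \<cdot> eval z"
  by (simp add: signed_eval_def mult_minus_left)

lemma signed_eval_times_left: "signed_eval (p, z \<odot> u) = eval z \<cdot> signed_eval (p, u)"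
  by (simp add: signed_eval_def mult_minus_right)

lemma mult_diff_left: "(x - y) \<cdot> a = x \<cdot> a - y \<cdot> a"
  using mult_add_left[of x "- y" a] by (simp add: mult_minus_left)

lemma mult_diff_right: "a \<cdot> (x - y) = a \<cdot> x - a \<cdot> y"
  using mult_add_right[of a x "- y"] by (simp add: mult_minus_right)

text \<open>The signs are opposite, so the difference is the sum of the two values up to sign; the
  descending axioms speak of such sums.\<close>

lemma signed_eval_flip_diff:
  assumes "eval u + eval v \<in> L S n"
  shows "signed_eval (p, u) - signed_eval (\<not> p, v) \<in> L S n"
proof (cases p)
  case True
  then have "signed_eval (p, u) - signed_eval (\<not> p, v) = - (eval u + eval v)"
    by (simp add: signed_eval_def)
  with assms show ?thesis
    unfolding L_def by (metis span_neg)
qed (use assms in \<open>simp add: signed_eval_def\<close>)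

text \<open>The four basic rules are the axioms on sums combined with the length bound for
  \<open>L2'\<close>. An extra factor multiplies the difference and raises the length bound by its
  own length.\<close>

lemma elementary_signed_eval:
  assumes "elementary k x y" "descending k" "letters (snd x) \<subseteq> S"
  shows "signed_eval x - signed_eval y \<in> L S (wlength (snd x) - 1)"
  using assms
proof (induction rule: elementary.induct)
  case (flexible1 p a b c)
  then show ?case
    using L2'_subset_L[of a S b c]
    by (intro signed_eval_flip_diff) (auto simp: descendingly_flexible_def)
next
  case (flexible2 p a b c)
  then show ?case
    using L2'_subset_L[of a S b c]
    by (intro signed_eval_flip_diff) (auto simp: descendingly_flexible_def add.assoc)
next
  case (alternative1 p a b c)
  then show ?case
    using L2'_subset_L[of a S b c]
    by (intro signed_eval_flip_diff) (auto simp: descendingly_alternative_def)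
next
  case (alternative2 p a b c)
  then show ?case
    using L2'_subset_L[of a S b c]
    by (intro signed_eval_flip_diff) (auto simp: descendingly_alternative_def add.assoc)
next
  case (times_right k p u q v z)
  then have "(signed_eval (p, u) - signed_eval (q, v)) \<cdot> eval z \<in> L S (wlength (u \<odot> z) - 1)"
    by (intro L_times_right) auto
  then show ?case
    unfolding mult_diff_left signed_eval_times_right[symmetric] by simp
next
  case (times_left k p u q v z)
  then have "eval z \<cdot> (signed_eval (p, u) - signed_eval (q, v)) \<in> L S (wlength (z \<odot> u) - 1)"
    by (intro L_times_left) auto
  then show ?case
    unfolding mult_diff_right signed_eval_times_left[symmetric] by simp
qed

lemma formally_equivalent_signed_eval:
  assumes "formally_equivalent k x y" "descending k" "letters (snd x) \<subseteq> S"
  shows "signed_eval x - signed_eval y \<in> L S (wlength (snd x) - 1)"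
proof -
  let ?L = "L S (wlength (snd x) - 1)"
  \<comment> \<open>Letters and length are carried through the induction so that all steps of the
    chain are measured in the same subspace \<open>?L\<close>; steps taken backwards only negate the
    difference.\<close>
  from assms(1) have "letters (snd y) = letters (snd x) \<and> wlength (snd y) = wlength (snd x) \<and>
      signed_eval x - signed_eval y \<in> ?L"
  proof (induction rule: formally_equivalent_induct)
    case refl
    then show ?case by (simp add: L_def span_zero)
  next
    case (step y z)
    then have inv: "letters (snd z) = letters (snd x)" "wlength (snd z) = wlength (snd x)"
      by (auto dest: elementary_invariants)
    from step(2) have "signed_eval y - signed_eval z \<in> ?L"
    proof
      assume "elementary k y z"
      from elementary_signed_eval[OF this] step inv assms show ?thesis by simp
    next
      assume "elementary k z y"
      from elementary_signed_eval[OF this] step inv assms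
      have "signed_eval z - signed_eval y \<in> ?L" by simp
      then show ?thesis
        unfolding L_def by (metis span_neg minus_diff_eq)
    qed
    moreover from step have "signed_eval x - signed_eval y \<in> ?L" by simp
    ultimately have "(signed_eval x - signed_eval y) + (signed_eval y - signed_eval z) \<in> ?L"
      unfolding L_def by (intro span_add)
    with inv show ?case by simp
  qed
  then show ?thesis by simp
qed

section \<open>Swappable letters of equal value\<close>

text \<open>At the root, the pattern with a repeated letter is a product that the axioms place in
  \<open>L1\<close>, hence in a shorter span. Deeper inside, the drop in length passes up through
  the remaining factors.\<close>

lemma swap_form_equal_eval:
  assumes "swap_form k s s y" "descending k" "letters y \<subseteq> S"
  shows "eval y \<in> L S (wlength y - 1)"
  using assms(1,3)
proof (induction y)
  case (Times u w)
  from Times.prems(1) consider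
      (top) v where "case k of
        Flexible \<Rightarrow> u \<odot> w = (Letter s \<odot> v) \<odot> Letter s \<or> u \<odot> w = Letter s \<odot> (v \<odot> Letter s)
      | Alternative \<Rightarrow> u \<odot> w = (v \<odot> Letter s) \<odot> Letter s \<or> u \<odot> w = Letter s \<odot> (Letter s \<odot> v)"
    | (left) "swap_form k s s u" | (right) "swap_form k s s w"
    unfolding swap_form_Times by blast
  then show ?case
  proof cases
    case top
    then have "s \<in> S" "letters v \<subseteq> S" "wlength (u \<odot> w) - 1 = wlength v + 1"
      using Times.prems(2) by (auto split: kind.splits)
    moreover have "eval (u \<odot> w) \<in> L1 s (eval v)"
      using top \<open>descending k\<close>
      by (auto split: kind.splits simp: descendingly_flexible_def descendingly_alternative_def)
    ultimately show ?thesis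
      using L1_subset_L by fastforce
  next
    case left
    with Times show ?thesis
      using L_times_right[of "eval u" S u w] by simp
  next
    case right
    with Times show ?thesis
      using L_times_left[of "eval w" S w u] by simp
  qed
qed simp

lemma swappable_equal_eval:
  assumes "swappable k x s t" "snd s = snd t" "descending k" "x \<in> words_upto S m"
  shows "eval x \<in> L S (m - 1)"
proof -
  let ?L = "L S (wlength x - 1)"
  from assms(1) obtain p y where y: "formally_equivalent k (False, number_from 0 x) (p, y)"
      "swap_form k s t y"
    by (rule swappableE)
  let ?y = "map_word snd y"
  have xS: "letters x \<subseteq> S" "wlength x \<le> m"
    using assms(4) by (auto simp: words_upto_def)
  \<comment> \<open>Forgetting positions turns the equivalence of numbered words into one starting
    at \<open>x\<close> itself and merges the two letters of the pattern.\<close>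
  have equiv: "formally_equivalent k (False, x) (p, ?y)"
    using formally_equivalent_map[OF y(1), of False snd] by simp
  have "swap_form k (snd s) (snd s) ?y"
    using swap_form_map[OF y(2), of snd] assms(2) by simp
  moreover have "letters ?y = letters x" "wlength ?y = wlength x"
    using formally_equivalent_invariants[OF equiv] by auto
  ultimately have "eval ?y \<in> ?L"
    using swap_form_equal_eval[of k "snd s" ?y S] assms(3) xS by simp
  then have "signed_eval (p, ?y) \<in> ?L"
    unfolding signed_eval_def L_def by (simp add: span_neg)
  moreover have "signed_eval (False, x) - signed_eval (p, ?y) \<in> ?L"
    using formally_equivalent_signed_eval[OF equiv assms(3)] xS by simp
  ultimately have "signed_eval (False, x) \<in> ?L"
    unfolding L_def by (metis span_add diff_add_cancel)
  then show ?thesis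
    \<comment> \<open>Here \<open>m\<close> only bounds the length of \<open>x\<close>, so
      monotonicity of the filtration finishes.\<close>
    using L_mono[of "wlength x - 1" "m - 1"] xS by (simp add: signed_eval_def)
qed

end

theorem proposition3p17:
  fixes scale :: "'f::field \<Rightarrow> 'a::ab_group_add \<Rightarrow> 'a"
    and mult :: "'a \<Rightarrow> 'a \<Rightarrow> 'a"
    and Basis S :: "'a set"
    and k :: kind
    and x :: "'a word"
  assumes "nonassoc_algebra scale mult"
    and "finite_dimensional_vector_space scale Basis"
    and "nonassoc_algebra.descending scale mult k"
    and "x \<in> words S"
  shows "((\<forall>s t. swappable k x s t \<longrightarrow> swappable k x t s) \<and>
          (\<forall>s t u. swappable k x s t \<longrightarrow> swappable k x t u \<longrightarrow> s \<noteq> u \<longrightarrow> swappable k x s u)) \<and>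
         (\<forall>m s t. x \<in> words_upto S m \<longrightarrow> swappable k x s t \<longrightarrow> snd s = snd t \<longrightarrow>
            nonassoc_algebra.eval mult x \<in> nonassoc_algebra.L scale mult S (m - 1)) \<and>
         (\<forall>m n P. x \<in> words_upto S m \<longrightarrow> finite S \<longrightarrow> n > card S \<longrightarrow>
            P \<subseteq> occurrences x \<longrightarrow> card P = n \<longrightarrow>
            (\<forall>s\<in>P. \<forall>t\<in>P. s \<noteq> t \<longrightarrow> swappable k x s t) \<longrightarrow>
            nonassoc_algebra.eval mult x \<in> nonassoc_algebra.L scale mult S (m - 1))"
proof -
  interpret nonassoc_algebra scale mult
    by fact
  \<comment> \<open>The values of the occurrences in \<open>P\<close> lie in \<open>S\<close>, which
    is smaller than \<open>P\<close>; hence \<open>snd\<close> is not injective on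
    \<open>P\<close>.\<close>
  have repeated: "\<exists>s\<in>P. \<exists>t\<in>P. s \<noteq> t \<and> snd s = snd t"
    if "x \<in> words_upto S m" "finite S" "card P > card S" "P \<subseteq> occurrences x" for m P
  proof -
    have "letters x = snd ` occurrences x"
      unfolding occurrences_def by (metis word.set_map map_word_snd_number_from)
    with that have "snd ` P \<subseteq> S"
      by (auto simp: words_upto_def)
    with that have "card (snd ` P) < card P"
      using card_mono[of S "snd ` P"] by simp
    then show ?thesis
      using pigeonhole[of snd P] unfolding inj_on_def by blast
  qed
  note equal = swappable_equal_eval[OF _ _ assms(3)]
  show ?thesis
  proof (intro conjI allI impI)
    fix m n P
    assume "x \<in> words_upto S m" "finite S" "n > card S" "P \<subseteq> occurrences x" "card P = n"
      and P: "\<forall>s\<in>P. \<forall>t\<in>P. s \<noteq> t \<longrightarrow> swappable k x s t"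
    with repeated obtain s t where "s \<in> P" "t \<in> P" "s \<noteq> t" "snd s = snd t"
      by blast
    with P \<open>x \<in> words_upto S m\<close> show "eval x \<in> L S (m - 1)"
      by (blast intro: equal)
  qed (blast intro: swappable_sym swappable_trans equal)+
qed

end
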